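(* Let $\sigma$ be a list of four real numbers with $\rho(\sigma)>0$. If $\sigma$ is realizable ($\mathcal{R}$), then either $\sigma$ is irreducibly realizable ($\mathcal{IR}$), or $\sigma$ is not spectrally simple and does not have Frobenius structure.
   Context: For a list $\sigma$ of $n$ complex numbers (repeats allowed), $\rho(\sigma)$ denotes the largest absolute value of an element of $\sigma$. The list $\sigma$ is realizable ($\mathcal{R}$) if there is an $n\times n$ entrywise nonnegative matrix whose list of eigenvalues, with multiplicities, is $\sigma$ (in that case $\rho(\sigma)$ is an element of $\sigma$); it is irreducibly realizable ($\mathcal{IR}$) if such a matrix can be chosen irreducible. A square matrix is irreducible if it is not similar by a permutation matrix to a nontrivially block triangular matrix. $\sigma$ is spectrally simple if $\rho(\sigma)$ has multiplicity $1$ in $\sigma$ and is the only element of $\sigma$ of absolute value $\rho(\sigma)$. Suppose $\sigma$ is not spectrally simple but is self-conjugate, has nonnegative sum, and contains $\rho=\rho(\sigma)$. Then $\sigma$ has Frobenius structure if the elements of $\sigma$ of absolute value $\rho$ are $h>1$ in number and are exactly $\rho$ times the $h$-th roots of unity (each once), while the remaining nonzero elements lie strictly inside this circle and, counted with multiplicity, are arranged on each inner circle as a self-conjugate union of sets of $h$ equally spaced points; any number of zeros is allowed. Equivalently, the monic polynomial whose list of roots is $\sigma$ has the form $$x^p\left(x^h-\rho^h\right)\left(x^h-(z_2\rho)^h\right)\cdots\left(x^h-(z_m\rho)^h\right)$$ with $h>1$, $p\ge 0$, and nonzero complex numbers $z_j$ with $|z_j|<1$ for $j=2,\dots,m$.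 *)

theory Defs
  imports
    Complex_Main
    "HOL-Library.Multiset"
    "HOL-Combinatorics.Permutations"
    "Jordan_Normal_Form.Char_Poly"
begin

(* Only meaningful for nonempty lists. *)
definition rho :: "complex list \<Rightarrow> real" where
  "rho \<sigma> = Max (cmod ` set \<sigma>)"

definition entrywise_nonneg :: "real mat \<Rightarrow> bool" where
  "entrywise_nonneg A \<longleftrightarrow> (\<forall>i < dim_row A. \<forall>j < dim_col A. A $$ (i, j) \<ge> 0)"

definition permutation_matrix :: "nat \<Rightarrow> real mat \<Rightarrow> bool" where
  "permutation_matrix n P \<longleftrightarrow>
     (\<exists>\<pi>. \<pi> permutes {..<n} \<and> P = mat n n (\<lambda>(i, j). if i = \<pi> j then 1 else 0))"

(* The diagonal blocks are square of sizes k and n - k, both nonzero. Upper form loses no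
   generality in irreducible_mat: reversing the order of the indices exchanges upper and lower. *)
definition block_triangular :: "nat \<Rightarrow> real mat \<Rightarrow> bool" where
  "block_triangular n B \<longleftrightarrow>
     (\<exists>k U V W. 0 < k \<and> k < n \<and>
        U \<in> carrier_mat k k \<and> V \<in> carrier_mat k (n - k) \<and> W \<in> carrier_mat (n - k) (n - k) \<and>
        B = four_block_mat U V (0\<^sub>m (n - k) k) W)"

definition irreducible_mat :: "real mat \<Rightarrow> bool" where
  "irreducible_mat A \<longleftrightarrow>
     square_mat A \<and>
     \<not> (\<exists>B P Q. similar_mat_wit A B P Q \<and> permutation_matrix (dim_row A) P \<and>
          block_triangular (dim_row A) B)"

(* The eigenvalues of A, counted with algebraic multiplicity, are the entries of the list. *)
definition has_spectrum :: "real mat \<Rightarrow> complex list \<Rightarrow> bool" where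
  "has_spectrum A \<sigma> \<longleftrightarrow>
     A \<in> carrier_mat (length \<sigma>) (length \<sigma>) \<and>
     char_poly (map_mat complex_of_real A) = (\<Prod>z\<leftarrow>\<sigma>. [:- z, 1:])"

definition realizable :: "complex list \<Rightarrow> bool" where
  "realizable \<sigma> \<longleftrightarrow> (\<exists>A. entrywise_nonneg A \<and> has_spectrum A \<sigma>)"

definition irreducibly_realizable :: "complex list \<Rightarrow> bool" where
  "irreducibly_realizable \<sigma> \<longleftrightarrow>
     (\<exists>A. entrywise_nonneg A \<and> irreducible_mat A \<and> has_spectrum A \<sigma>)"

definition spectrally_simple :: "complex list \<Rightarrow> bool" where
  "spectrally_simple \<sigma> \<longleftrightarrow>
     count (mset \<sigma>) (complex_of_real (rho \<sigma>)) = 1 \<and>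
     (\<forall>z \<in> set \<sigma>. cmod z = rho \<sigma> \<longrightarrow> z = complex_of_real (rho \<sigma>))"

definition self_conjugate :: "complex multiset \<Rightarrow> bool" where
  "self_conjugate M \<longleftrightarrow> image_mset cnj M = M"

(* w times the h-th roots of unity, each once *)
definition equally_spaced :: "nat \<Rightarrow> complex \<Rightarrow> complex multiset" where
  "equally_spaced h w = {# w * cis (2 * pi * real k / real h). k \<in># mset_set {..<h} #}"

(* The first four conjuncts are the standing assumptions under which the notion is defined;
   the third one needs only the real part, since the sum of a self-conjugate list is real. *)
definition has_Frobenius_structure :: "complex list \<Rightarrow> bool" where
  "has_Frobenius_structure \<sigma> \<longleftrightarrow>
     \<not> spectrally_simple \<sigma> \<and>
     self_conjugate (mset \<sigma>) \<and>
     Re (sum_list \<sigma>) \<ge> 0 \<and>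
     complex_of_real (rho \<sigma>) \<in> set \<sigma> \<and>
     (\<exists>h > 1.
        {# z \<in># mset \<sigma>. cmod z = rho \<sigma> #} = equally_spaced h (complex_of_real (rho \<sigma>)) \<and>
        (\<forall>r. 0 < r \<and> r < rho \<sigma> \<longrightarrow>
           self_conjugate {# z \<in># mset \<sigma>. cmod z = r #} \<and>
           (\<exists>W. {# z \<in># mset \<sigma>. cmod z = r #} = (\<Sum>w\<in>#W. equally_spaced h w))))"

end

(* A block matrix with rows (P, Q) and (Q, P) is nonnegative with spectrum {a, b, c, d} as soon as
   S = P + Q and T = P - Q have spectra that together make up {a, b, c, d} and |T| <= S entrywise.
   For a > b >= c >= d with nonnegative sum, either b + c <= a + d, and S, T can be taken symmetric
   circulant with spectra {a, d} and {b, c}; or b + c > a + d, which forces |c| <= b, and T = diag(d, c)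
   works with an S of spectrum {a, b} and diagonal entries strictly between b and a. For real lists,
   Frobenius structure forces h = 2, so the list is r, x, -x, -r and falls under the first case.
   Realizability enters only through the trace. *)
theory Submission
  imports Defs
begin

section \<open>The sum of the spectrum as the trace\<close>

text \<open>The derivative of the characteristic polynomial is the sum of those of the principal
  minors obtained by deleting one index, which allows induction on the size.\<close>

lemma coeff_char_poly_trace:
  fixes A :: "'a :: {idom, ring_char_0} mat"
  assumes "A \<in> carrier_mat (Suc n) (Suc n)"
  shows "coeff (char_poly A) n = - (\<Sum>i<Suc n. A $$ (i, i))"
  using assms
proof (induction n arbitrary: A)
  case 0
  then have "char_poly A = [:- (A $$ (0, 0)), 1:]"
    unfolding char_poly_defs by (subst det_single) auto
  then show ?case by simp
next
  case (Suc n)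
  let ?t = "\<Sum>i<Suc (Suc n). A $$ (i, i)"
  have minor: "coeff (char_poly (mat_delete A i i)) n = A $$ (i, i) - ?t"
    if i: "i < Suc (Suc n)" for i
  proof -
    have D: "mat_delete A i i \<in> carrier_mat (Suc n) (Suc n)"
      using mat_delete_carrier[OF Suc.prems] by simp
    have "(\<Sum>j<Suc n. mat_delete A i i $$ (j, j)) =
        (\<Sum>j<Suc n. A $$ (insert_index i j, insert_index i j))"
      by (rule sum.cong) (use mat_delete_index[OF Suc.prems i i] in auto)
    also have "\<dots> = (\<Sum>j\<in>insert_index i ` {0..<Suc n}. A $$ (j, j))"
      by (subst sum.reindex[OF insert_index_inj_on]) (simp add: lessThan_atLeast0)
    also have "\<dots> = ?t - A $$ (i, i)"
      unfolding insert_index_image[OF i] using i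
      by (simp add: sum_diff1 lessThan_atLeast0 del: sum.lessThan_Suc sum.atLeastLessThan_Suc sum.op_ivl_Suc)
    finally show ?thesis using Suc.IH[OF D] by simp
  qed
  \<comment> \<open>Each diagonal entry survives in all but one of the \<open>n + 2\<close> minors,
    so the factor \<open>n + 1\<close> appears on both sides and cancels in characteristic
    zero.\<close>
  have "of_nat (Suc n) * coeff (char_poly A) (Suc n) = coeff (pderiv (char_poly A)) n"
    by (simp add: coeff_pderiv)
  also have "\<dots> = (\<Sum>i<Suc (Suc n). A $$ (i, i) - ?t)"
    unfolding pderiv_char_poly[OF Suc.prems] coeff_sum using minor by (intro sum.cong) auto
  also have "\<dots> = ?t - of_nat (Suc (Suc n)) * ?t"
    unfolding sum_subtractf by simp
  also have "\<dots> = of_nat (Suc n) * (- ?t)"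
    by (simp add: algebra_simps del: sum.lessThan_Suc)
  finally show ?case
    by (metis mult_left_cancel of_nat_eq_0_iff nat.distinct(2))
qed

lemma coeff_prod_linear_factors:
  fixes zs :: "'a :: idom list"
  shows "length zs = Suc n \<Longrightarrow> coeff (\<Prod>z\<leftarrow>zs. [:- z, 1:]) n = - sum_list zs"
proof (induction zs arbitrary: n)
  case (Cons z zs)
  let ?p = "\<Prod>z\<leftarrow>zs. [:- z, 1:]"
  have deg: "degree (\<Prod>z\<leftarrow>ys. [:- z, 1:]) = length ys" for ys :: "'a list"
    by (rule degree_linear_factors)
  have "coeff ?p (length zs) = 1"
    by (induction zs) (simp_all add: coeff_eq_0 deg)
  then show ?case
    using Cons by (cases n) auto
qed simp

lemma sum_spectrum_nonneg:
  assumes "realizable \<sigma>" "\<sigma> \<noteq> []"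
  shows "Re (sum_list \<sigma>) \<ge> 0"
proof -
  obtain A n where A: "entrywise_nonneg A" "A \<in> carrier_mat (Suc n) (Suc n)"
    "char_poly (map_mat complex_of_real A) = (\<Prod>z\<leftarrow>\<sigma>. [:- z, 1:])" "length \<sigma> = Suc n"
    using assms unfolding realizable_def has_spectrum_def by (metis length_Suc_conv list.exhaust)
  have "- sum_list \<sigma> = - (\<Sum>i<Suc n. complex_of_real (A $$ (i, i)))"
    using coeff_prod_linear_factors[OF A(4)] coeff_char_poly_trace[of "map_mat complex_of_real A" n] A(2,3)
    by simp
  then have "Re (sum_list \<sigma>) = (\<Sum>i<Suc n. A $$ (i, i))"
    by (metis neg_equal_iff_equal of_real_sum Re_complex_of_real)
  also have "\<dots> \<ge> 0"
    using A(1,2) unfolding entrywise_nonneg_def by (intro sum_nonneg) auto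
  finally show ?thesis .
qed

section \<open>Characteristic polynomials of small and of symmetric block matrices\<close>

lemma det_2x2:
  fixes A :: "'a :: comm_ring_1 mat"
  assumes "A \<in> carrier_mat 2 2"
  shows "det A = A $$ (0, 0) * A $$ (1, 1) - A $$ (0, 1) * A $$ (1, 0)"
proof -
  have "mat_delete A i 0 \<in> carrier_mat 1 1" for i
    using mat_delete_carrier[OF assms] by (metis One_nat_def diff_Suc_1 numeral_2_eq_2)
  then have "det (mat_delete A i 0) = mat_delete A i 0 $$ (0, 0)" for i
    by (rule det_single)
  then show ?thesis
    using laplace_expansion_column[OF assms, of 0] assms
    by (simp add: cofactor_def mat_delete_def numeral_2_eq_2)
qed

lemma char_poly_2x2:
  fixes A :: "'a :: comm_ring_1 mat"
  assumes "A \<in> carrier_mat 2 2"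
  shows "char_poly A =
    [:A $$ (0, 0) * A $$ (1, 1) - A $$ (0, 1) * A $$ (1, 0), - (A $$ (0, 0) + A $$ (1, 1)), 1:]"
  unfolding char_poly_def
  by (subst det_2x2) (use assms in \<open>auto simp: char_poly_matrix_def\<close>)

text \<open>Conjugation by the unipotent matrix \<open>?L\<close> produces a block triangular matrix
  with diagonal blocks \<open>A + B\<close> and \<open>A - B\<close>. Unlike a full block
  diagonalisation it requires no division by 2.\<close>

lemma char_poly_block_symmetric:
  fixes A B :: "'a :: idom mat"
  assumes A: "A \<in> carrier_mat n n" and B: "B \<in> carrier_mat n n"
  shows "char_poly (four_block_mat A B B A) = char_poly (A + B) * char_poly (A - B)"
proof -
  let ?M = "four_block_mat A B B A"
  let ?U = "four_block_mat (A + B) B (0\<^sub>m n n) (A - B)"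
  let ?L = "four_block_mat (1\<^sub>m n) (0\<^sub>m n n) (1\<^sub>m n) (1\<^sub>m n) :: 'a mat"
  let ?K = "four_block_mat (1\<^sub>m n) (0\<^sub>m n n) (- 1\<^sub>m n) (1\<^sub>m n) :: 'a mat"
  have LK: "?L * ?K = 1\<^sub>m (n + n)" "?K * ?L = 1\<^sub>m (n + n)"
    by (auto simp: mult_four_block_mat[of _ n n _ n _ n _ _ n _ n] intro!: eq_matI)
  have LU: "?L * ?U = four_block_mat (A + B) B (A + B) A"
    by (subst mult_four_block_mat[of _ n n _ n _ n _ _ n _ n])
      (use A B in \<open>auto intro!: cong_four_block_mat\<close>)
  have MU: "?M = ?L * ?U * ?K"
    unfolding LU by (subst mult_four_block_mat[of _ n n _ n _ n _ _ n _ n])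
      (use A B in \<open>auto intro!: cong_four_block_mat\<close>)
  have "similar_mat ?M ?U"
    by (rule similar_matI[OF _ LK MU]) (use A B in auto)
  then have "char_poly ?M = char_poly ?U"
    by (rule char_poly_similar)
  also have "char_poly_matrix ?U =
      four_block_mat (char_poly_matrix (A + B)) (map_mat (\<lambda>a. [:- a:]) B) (0\<^sub>m n n) (char_poly_matrix (A - B))"
    using A B by (intro eq_matI) (auto simp: char_poly_matrix_def)
  then have "char_poly ?U = char_poly (A + B) * char_poly (A - B)"
    unfolding char_poly_def using A B by (subst det_four_block_mat_lower_left_zero[symmetric])
      (auto intro!: minus_carrier_mat char_poly_matrix_closed)
  finally show ?thesis .
qed

section \<open>Irreducibility and realization by block matrices\<close>

text \<open>If a permutation \<open>\<pi>\<close> made \<open>A\<close> block triangular, the image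
  \<open>J\<close> of the first \<open>k\<close> indices would be a proper nonempty set whose
  columns vanish in all rows outside \<open>J\<close>.\<close>

lemma irreducible_matI:
  assumes A: "A \<in> carrier_mat n n"
    and conn: "\<And>J. J \<subset> {..<n} \<Longrightarrow> J \<noteq> {} \<Longrightarrow> \<exists>i\<in>{..<n} - J. \<exists>j\<in>J. A $$ (i, j) \<noteq> 0"
  shows "irreducible_mat A"
  unfolding irreducible_mat_def
proof (intro conjI notI)
  show "square_mat A" using A by auto
next
  assume "\<exists>B P Q. similar_mat_wit A B P Q \<and> permutation_matrix (dim_row A) P \<and>
    block_triangular (dim_row A) B"
  then obtain B P Q \<pi> k U V W where w: "similar_mat_wit A B P Q" and \<pi>: "\<pi> permutes {..<n}"
    and P: "P = mat n n (\<lambda>(i, j). if i = \<pi> j then 1 else 0)"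
    and k: "0 < k" "k < n" and B: "B = four_block_mat U V (0\<^sub>m (n - k) k) W"
    and UW: "U \<in> carrier_mat k k" "W \<in> carrier_mat (n - k) (n - k)"
    using A unfolding permutation_matrix_def block_triangular_def by auto
  have carr: "B \<in> carrier_mat n n" "P \<in> carrier_mat n n" "Q \<in> carrier_mat n n"
    and QP: "Q * P = 1\<^sub>m n" and AB: "A = P * B * Q"
    using w A unfolding similar_mat_wit_def Let_def by auto
  have "A * P = P * B * (Q * P)"
    unfolding AB using carr by (meson assoc_mult_mat mult_carrier_mat)
  then have AP: "A * P = P * B"
    using QP carr by simp
  \<comment> \<open>Comparing \<open>A * P\<close> with \<open>P * B\<close> at
    \<open>(\<pi> i, j)\<close> avoids an explicit form of the inverse \<open>Q\<close>.\<close>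
  have entry: "A $$ (\<pi> i, \<pi> j) = B $$ (i, j)" if "i < n" "j < n" for i j
  proof -
    have \<pi>n: "\<pi> i < n" "\<pi> j < n" using permutes_in_image[OF \<pi>] that by auto
    have "(A * P) $$ (\<pi> i, j) = (\<Sum>l<n. A $$ (\<pi> i, l) * (if l = \<pi> j then 1 else 0))"
      using A \<pi>n that by (simp add: P scalar_prod_def lessThan_atLeast0)
    also have "\<dots> = A $$ (\<pi> i, \<pi> j)"
      using \<pi>n by (simp add: if_distrib[of "times _"] cong: if_cong)
    finally have AP': "(A * P) $$ (\<pi> i, j) = A $$ (\<pi> i, \<pi> j)" .
    have "(P * B) $$ (\<pi> i, j) = (\<Sum>l<n. (if \<pi> i = \<pi> l then 1 else 0) * B $$ (l, j))"
      using carr(1) \<pi>n that by (simp add: P scalar_prod_def lessThan_atLeast0)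
    also have "\<dots> = (\<Sum>l<n. if i = l then B $$ (l, j) else 0)"
      by (rule sum.cong) (use permutes_inj[OF \<pi>] in \<open>auto simp: inj_eq\<close>)
    also have "\<dots> = B $$ (i, j)"
      using that by simp
    finally show ?thesis using AP AP' by simp
  qed
  let ?J = "\<pi> ` {..<k}"
  have "?J \<subseteq> {..<n}" using permutes_in_image[OF \<pi>] k by fastforce
  moreover have "card ?J = k" using permutes_inj_on[OF \<pi>] by (simp add: card_image)
  ultimately have "?J \<subset> {..<n}" "?J \<noteq> {}" using k by auto
  from conn[OF this] obtain i j where i: "i \<in> {..<n} - ?J" and j: "j < k" "A $$ (i, \<pi> j) \<noteq> 0"
    by auto
  obtain i' where i': "i = \<pi> i'" "i' < n" "\<not> i' < k"
  proof -
    have "i \<in> \<pi> ` {..<n}" using i permutes_image[OF \<pi>] by simp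
    with i that show ?thesis by auto
  qed
  have "A $$ (i, \<pi> j) = 0"
    using entry[of i' j] i' j(1) k UW by (simp add: B)
  with j show False by simp
qed

text \<open>The strict bounds \<open>off\<close> make the off-diagonal entries of both blocks
  positive. Hence the graph of \<open>M\<close> contains all edges between even and odd indices,
  which already connects it.\<close>

lemma irreducibly_realizable_blockI:
  assumes S: "S \<in> carrier_mat 2 2" and T: "T \<in> carrier_mat 2 2"
    and le: "\<And>i j. i < 2 \<Longrightarrow> j < 2 \<Longrightarrow> \<bar>T $$ (i, j)\<bar> \<le> S $$ (i, j)"
    and off: "\<bar>T $$ (0, 1)\<bar> < S $$ (0, 1)" "\<bar>T $$ (1, 0)\<bar> < S $$ (1, 0)"
    and chS: "char_poly S = [:- a, 1:] * [:- b, 1:]"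
    and chT: "char_poly T = [:- c, 1:] * [:- d, 1:]"
    and \<sigma>: "mset \<sigma> = image_mset complex_of_real {#a, b, c, d#}"
  shows "irreducibly_realizable \<sigma>"
proof -
  define P where "P = mat 2 2 (\<lambda>ij. (S $$ ij + T $$ ij) / 2)"
  define Q where "Q = mat 2 2 (\<lambda>ij. (S $$ ij - T $$ ij) / 2)"
  define M where "M = four_block_mat P Q Q P"
  have P: "P \<in> carrier_mat 2 2" and Q: "Q \<in> carrier_mat 2 2" by (auto simp: P_def Q_def)
  have M: "M \<in> carrier_mat 4 4"
    using four_block_carrier_mat[OF P P] by (simp add: M_def)
  have "P + Q = S" "P - Q = T"
    using S T by (auto intro!: eq_matI simp: P_def Q_def field_simps)
  then have chM: "char_poly M = [:- a, 1:] * [:- b, 1:] * ([:- c, 1:] * [:- d, 1:])"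
    unfolding M_def char_poly_block_symmetric[OF P Q] by (simp only: chS chT)
  have "length \<sigma> = 4" using arg_cong[OF \<sigma>, of size] by simp
  moreover have "char_poly (map_mat complex_of_real M) = (\<Prod>z\<leftarrow>\<sigma>. [:- z, 1:])"
  proof -
    interpret h: map_poly_comm_ring_hom complex_of_real ..
    have "char_poly (map_mat complex_of_real M) = map_poly complex_of_real (char_poly M)"
      by (rule of_real_hom.char_poly_hom[OF M])
    also have "\<dots> = (\<Prod>z\<in>#mset \<sigma>. [:- z, 1:])"
      unfolding chM \<sigma> by (simp only: h.hom_mult) (simp add: algebra_simps)
    finally show ?thesis by (simp only: prod_mset_prod_list mset_map[symmetric])
  qed
  moreover have "entrywise_nonneg M"
    unfolding entrywise_nonneg_def
  proof (intro allI impI)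
    fix i j assume "i < dim_row M" "j < dim_col M"
    then have ij: "i < 4" "j < 4" using M by auto
    have "0 \<le> P $$ (k, l)" "0 \<le> Q $$ (k, l)" if "k < 2" "l < 2" for k l
      using le[OF that] that by (auto simp: P_def Q_def)
    then show "0 \<le> M $$ (i, j)"
      using ij P Q by (auto simp: M_def)
  qed
  moreover have "irreducible_mat M"
  proof (rule irreducible_matI[OF M])
    fix J :: "nat set" assume J: "J \<subset> {..<4}" "J \<noteq> {}"
    have pos: "M $$ (i, j) \<noteq> 0" if "i < 4" "j < 4" "even i \<noteq> even j" for i j
    proof -
      have "i \<in> {0, 1, 2, 3}" "j \<in> {0, 1, 2, 3}" using that by auto
      then show ?thesis
        using off that(3) by (auto simp: M_def P_def Q_def)
    qed
    have all: "{..<4} = {0, 1, 2, 3 :: nat}" by auto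
    show "\<exists>i\<in>{..<4} - J. \<exists>j\<in>J. M $$ (i, j) \<noteq> 0"
    proof (rule ccontr)
      assume "\<not> ?thesis"
      then have cl: "i \<in> J" if "j \<in> J" "i < 4" "even i \<noteq> even j" for i j
        using pos[of i j] that J by auto
      from J obtain j where "j \<in> J" "j < 4" by auto
      have "i \<in> J" if "i < 4" for i
      proof (cases "even i = even j")
        case True
        \<comment> \<open>Between indices of equal parity, pass through 0 or 1, whichever has the
          other parity.\<close>
        then show ?thesis
          using cl[OF \<open>j \<in> J\<close>, of "if even j then 1 else 0"] cl[of "if even j then 1 else 0" i] that
          by (auto split: if_splits)
      next
        case False
        then show ?thesis using cl \<open>j \<in> J\<close> that by blast
      qed
      with J show False by auto
    qed
  qed
  ultimately show ?thesis
    using M unfolding irreducibly_realizable_def has_spectrum_def by auto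
qed

section \<open>Construction of the two blocks from the ordered spectrum\<close>

text \<open>The hypothesis \<open>gap\<close> joins the two sources of such lists:
  \<open>- a < d\<close> comes from spectral simplicity, the other alternative from Frobenius
  structure.\<close>

lemma irreducibly_realizable_of_spectral_gap:
  fixes a b c d :: real
  assumes ord: "b < a" "c \<le> b" "d \<le> c"
    and sum: "0 \<le> a + b + c + d"
    and gap: "- a < d \<or> d = - a \<and> c = - b"
    and \<sigma>: "mset \<sigma> = image_mset complex_of_real {#a, b, c, d#}"
  shows "irreducibly_realizable \<sigma>"
proof (cases "b + c \<le> a + d")
  case True
  \<comment> \<open>The diagonal bound \<open>|b + c| <= a + d\<close> combines the case assumption
    with \<open>sum\<close>. The strict off-diagonal bound \<open>b - c < a - d\<close> follows from
    \<open>b < a\<close> and \<open>d <= c\<close>.\<close>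
  let ?S = "mat 2 2 (\<lambda>(i, j). if i = j then (a + d) / 2 else (a - d) / 2)"
  let ?T = "mat 2 2 (\<lambda>(i, j). if i = j then (b + c) / 2 else (b - c) / 2)"
  show ?thesis
  proof (rule irreducibly_realizable_blockI[of ?S ?T a d b c])
    show "char_poly ?S = [:- a, 1:] * [:- d, 1:]" "char_poly ?T = [:- b, 1:] * [:- c, 1:]"
      by (auto simp: char_poly_2x2 field_simps power2_eq_square)
    show "mset \<sigma> = image_mset complex_of_real {#a, d, b, c#}"
      unfolding \<sigma> by simp
  qed (use True ord sum in \<open>auto simp: abs_if field_simps\<close>)
next
  case False
  \<comment> \<open>Any s strictly between max b (- d) and a would do.\<close>
  define s where "s = (max b (- d) + a) / 2"
  \<comment> \<open>With diagonal \<open>s\<close>, \<open>a + b - s\<close> and both off-diagonal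
    entries \<open>p\<close>, the determinant is \<open>a * b\<close>. The radicand equals
    \<open>(a - s) * (s - b)\<close>.\<close>
  define p where "p = sqrt (s * (a + b - s) - a * b)"
  \<comment> \<open>The other alternative of \<open>gap\<close> would give
    \<open>b + c = 0 = a + d\<close>, contrary to the case assumption.\<close>
  have d: "- a < d" using False gap by auto
  have s: "b < s" "s < a" "- d < s" using d ord by (auto simp: s_def max_def field_simps)
  have "0 < (a - s) * (s - b)" using s by simp
  also have "\<dots> = s * (a + b - s) - a * b" by (simp add: algebra_simps)
  finally have p: "0 < p" "p * p = s * (a + b - s) - a * b" by (simp_all add: p_def)
  let ?S = "mat 2 2 (\<lambda>(i, j). if i \<noteq> j then p else if i = 0 then s else a + b - s)"
  let ?T = "mat 2 2 (\<lambda>(i, j). if i \<noteq> j then 0 else if i = 0 then d else c)"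
  show ?thesis
  proof (rule irreducibly_realizable_blockI[of ?S ?T a b d c])
    show "char_poly ?S = [:- a, 1:] * [:- b, 1:]" "char_poly ?T = [:- d, 1:] * [:- c, 1:]"
      by (auto simp: char_poly_2x2 p algebra_simps)
    show "mset \<sigma> = image_mset complex_of_real {#a, b, d, c#}"
      unfolding \<sigma> by simp
    \<comment> \<open>For \<open>d\<close>: \<open>d <= b < s\<close> and \<open>- d < s\<close>.
      For \<open>c\<close>: \<open>a + b - s > b >= c\<close>, while
      \<open>b + c > a + d > 0\<close> yields \<open>- c < b\<close>.\<close>
    show "\<bar>?T $$ (i, j)\<bar> \<le> ?S $$ (i, j)" if "i < 2" "j < 2" for i j
      using that p s False ord d by (auto simp: abs_if)
  qed (use p in auto)
qed

section \<open>Reduction of simple and Frobenius lists to ordered spectra\<close>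

lemma equally_spaced_2: "equally_spaced 2 w = {#w, - w#}"
proof -
  have "mset_set {..<2 :: nat} = {#0, 1#}"
    by (simp add: numeral_2_eq_2 lessThan_Suc)
  then show ?thesis by (simp add: equally_spaced_def)
qed

lemma cmod_le_rho: "z \<in> set \<sigma> \<Longrightarrow> cmod z \<le> rho \<sigma>"
  unfolding rho_def by simp

text \<open>After sorting, multiplicity one gives \<open>b < a\<close>, and uniqueness on the
  spectral circle excludes \<open>d = - a\<close>.\<close>

lemma irreducibly_realizable_of_simple:
  assumes len: "length \<sigma> = 4" and real: "\<forall>z \<in> set \<sigma>. z \<in> \<real>" and pos: "rho \<sigma> > 0"
    and sum: "0 \<le> Re (sum_list \<sigma>)" and simple: "spectrally_simple \<sigma>"
  shows "irreducibly_realizable \<sigma>"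
proof -
  define xs where "xs = sort (map Re \<sigma>)"
  have "length xs = 4" using len by (simp add: xs_def)
  then obtain a b c d where xs: "xs = [d, c, b, a]"
    by (auto simp: numeral_eq_Suc length_Suc_conv)
  have "mset \<sigma> = image_mset (\<lambda>z. complex_of_real (Re z)) (mset \<sigma>)"
    using real image_mset_cong[of "mset \<sigma>" "\<lambda>z. complex_of_real (Re z)" id] by simp
  also have "\<dots> = image_mset complex_of_real (mset xs)"
    by (simp add: xs_def multiset.map_comp comp_def)
  finally have \<sigma>: "mset \<sigma> = image_mset complex_of_real {#a, b, c, d#}"
    by (simp add: xs add_mset_commute)
  have "sorted xs" by (simp add: xs_def)
  then have ord: "d \<le> c" "c \<le> b" "b \<le> a" by (auto simp: xs)
  have set: "set \<sigma> = complex_of_real ` {a, b, c, d}"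
    using arg_cong[OF \<sigma>, of set_mset] by simp
  \<comment> \<open>Count one places the spectral radius itself in the list, so it is the largest
    entry \<open>a\<close> and not merely \<open>- d\<close>.\<close>
  have "complex_of_real (rho \<sigma>) \<in> set \<sigma>" and cnt: "count (mset \<sigma>) (complex_of_real (rho \<sigma>)) = 1"
    using simple unfolding spectrally_simple_def by (auto simp flip: count_greater_zero_iff set_mset_mset)
  then have "rho \<sigma> \<in> {a, b, c, d}" unfolding set by auto
  then have "rho \<sigma> \<le> a" using ord by auto
  moreover have "\<bar>a\<bar> \<le> rho \<sigma>" and ad: "\<bar>d\<bar> \<le> rho \<sigma>"
    using cmod_le_rho[of "complex_of_real a" \<sigma>] cmod_le_rho[of "complex_of_real d" \<sigma>] by (auto simp: set)
  ultimately have a: "rho \<sigma> = a" by simp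
  have "b \<noteq> a" using cnt unfolding \<sigma> a by auto
  moreover have "d \<noteq> - a"
    using simple pos unfolding spectrally_simple_def a set by auto
  moreover have "Re (sum_list \<sigma>) = a + b + c + d"
    using arg_cong[OF \<sigma>, of sum_mset] by (simp add: sum_mset_sum_list)
  ultimately show ?thesis
    using irreducibly_realizable_of_spectral_gap[of b a c d \<sigma>] ord sum ad \<sigma> by (auto simp: a)
qed

text \<open>The outer circle consists of one pair of opposite reals. The two remaining entries
  cancel as well, which leads to the second alternative of the gap condition.\<close>

lemma irreducibly_realizable_of_Frobenius:
  assumes len: "length \<sigma> = 4" and real: "\<forall>z \<in> set \<sigma>. z \<in> \<real>" and pos: "rho \<sigma> > 0"
    and frob: "has_Frobenius_structure \<sigma>"
  shows "irreducibly_realizable \<sigma>"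
proof -
  define \<rho> where "\<rho> = rho \<sigma>"
  obtain h where "1 < h"
    and outer: "{# z \<in># mset \<sigma>. cmod z = \<rho> #} = equally_spaced h (complex_of_real \<rho>)"
    and inner: "\<And>r. 0 < r \<Longrightarrow> r < \<rho> \<Longrightarrow>
      \<exists>W. {# z \<in># mset \<sigma>. cmod z = r #} = (\<Sum>w\<in>#W. equally_spaced h w)"
    using frob unfolding has_Frobenius_structure_def \<rho>_def by blast
  have "h = 2"
  proof (rule ccontr)
    assume "h \<noteq> 2"
    then have h: "h > 2" using \<open>1 < h\<close> by simp
    \<comment> \<open>For \<open>h > 2\<close> this point has argument strictly between 0 and
      \<open>pi\<close>, so it is not real.\<close>
    let ?z = "complex_of_real \<rho> * cis (2 * pi * real 1 / real h)"
    have "?z \<in># equally_spaced h (complex_of_real \<rho>)"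
      unfolding equally_spaced_def using \<open>1 < h\<close> by (auto intro!: rev_image_eqI[of 1])
    then have "?z \<in> \<real>" using real unfolding outer[symmetric] by auto
    then have "sin (2 * pi / h) = 0"
      using pos by (simp add: complex_is_Real_iff \<rho>_def)
    moreover have "0 < sin (2 * pi / h)"
      using h by (intro sin_gt_zero) (auto simp: field_simps)
    ultimately show False by simp
  qed
  \<comment> \<open>Pairs \<open>w\<close>, \<open>- w\<close> cancel, so the vanishing sum on each
    inner circle replaces the unknown decomposition \<open>W\<close>.\<close>
  have inner_sum: "sum_mset {# z \<in># mset \<sigma>. cmod z = r #} = 0" if "0 < r" "r < \<rho>" for r
  proof -
    obtain W where W: "{# z \<in># mset \<sigma>. cmod z = r #} = (\<Sum>w\<in>#W. equally_spaced h w)"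
      using inner \<open>0 < r\<close> \<open>r < \<rho>\<close> by blast
    show ?thesis unfolding W \<open>h = 2\<close>
      by (induction W) (auto simp: equally_spaced_2)
  qed
  let ?N = "{# z \<in># mset \<sigma>. cmod z \<noteq> \<rho> #}"
  have split: "mset \<sigma> = {#complex_of_real \<rho>, - complex_of_real \<rho>#} + ?N"
    using multiset_partition[of "mset \<sigma>" "\<lambda>z. cmod z = \<rho>"]
    unfolding outer \<open>h = 2\<close> equally_spaced_2 .
  have "length \<sigma> = size ({#complex_of_real \<rho>, - complex_of_real \<rho>#} + ?N)"
    unfolding split[symmetric] by simp
  then have "size ?N = 2" using len by simp
  then obtain z w where N: "?N = {#z, w#}"
    by (metis One_nat_def Suc_1 add_right_cancel plus_1_eq_Suc size_1_singleton_mset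
        size_add_mset size_eq_Suc_imp_eq_union nat.inject)
  have "z \<in># ?N" "w \<in># ?N" by (simp_all add: N)
  then have zw: "z \<in> set \<sigma>" "w \<in> set \<sigma>" "cmod z < \<rho>" "cmod w < \<rho>"
    using cmod_le_rho[of _ \<sigma>] by (auto simp: \<rho>_def less_le)
  have \<sigma>: "mset \<sigma> = {#complex_of_real \<rho>, - complex_of_real \<rho>, z, w#}"
    using split N by simp
  have rest_sum: "sum_mset {# v \<in># {#z, w#}. cmod v = r #} = 0" if "0 < r" "r < \<rho>" for r
  proof -
    have "\<bar>\<rho>\<bar> \<noteq> r" using that by simp
    then show ?thesis using inner_sum[OF that] unfolding \<sigma> by simp
  qed
  \<comment> \<open>A nonzero entry alone on its circle would contradict the zero sum there. So both
    entries are zero, or they share a circle and cancel.\<close>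
  have "z + w = 0"
    using rest_sum[of "cmod z"] rest_sum[of "cmod w"] zw(3,4)
    by (cases "z = 0"; cases "w = 0"; cases "cmod z = cmod w") auto
  moreover obtain x where x: "z = complex_of_real x"
    using real zw(1) by (meson Reals_cases)
  ultimately have w: "w = complex_of_real (- x)"
    by (simp add: add_eq_0_iff)
  have \<sigma>': "mset \<sigma> = image_mset complex_of_real {#\<rho>, \<bar>x\<bar>, - \<bar>x\<bar>, - \<rho>#}"
    unfolding \<sigma> x w by (simp add: abs_if)
  show ?thesis
    by (rule irreducibly_realizable_of_spectral_gap[OF _ _ _ _ _ \<sigma>']) (use zw(3) x in auto)
qed

theorem theorem20:
  fixes \<sigma> :: "complex list"
  assumes "length \<sigma> = 4"
    and "\<forall>z \<in> set \<sigma>. z \<in> \<real>"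
    and "rho \<sigma> > 0"
    and "realizable \<sigma>"
  shows "irreducibly_realizable \<sigma> \<or>
         (\<not> spectrally_simple \<sigma> \<and> \<not> has_Frobenius_structure \<sigma>)"
proof -
  have "0 \<le> Re (sum_list \<sigma>)"
    using sum_spectrum_nonneg assms(1,4) by fastforce
  then show ?thesis
    using irreducibly_realizable_of_simple irreducibly_realizable_of_Frobenius assms(1-3) by blast
qed

end
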